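(* Let $N\ge1$ be an integer and let $\mathbf v=(v_0,\dots,v_{N-1})$ be a real vector. For every real number $r$, the fractional index sample $v_r$ satisfies $$v_r=\sum_{n=0}^{N-1}w_n(r)\,v_n,$$ where, for $n=0,1,\dots,N-1$, $$w_n(r)=-\frac1N+\frac2N\sum_{k=0}^{N-1}\cos\left(\frac{\pi k(n+1/2)}{N}\right)\cos\left(\frac{\pi k(r+1/2)}{N}\right).$$
   Context: The DCT spectrum of $\mathbf v=(v_0,\dots,v_{N-1})$ is $$V_k=\sqrt{\tfrac2N}\,\alpha_k\sum_{n=0}^{N-1}v_n\cos\left(\frac{\pi k(n+1/2)}{N}\right),\quad k=0,\dots,N-1,$$ where $\alpha_0=1/\sqrt2$ and $\alpha_k=1$ for $k\ge1$. For any real number $r$, the (possibly fractional index) sample $v_r$ is defined by extending the inverse DCT formula to noninteger indices: $$v_r=\sqrt{\tfrac2N}\sum_{k=0}^{N-1}\alpha_kV_k\cos\left(\frac{\pi k(r+1/2)}{N}\right).$$ (For integer $r\in\{0,\dots,N-1\}$ this is the usual inverse DCT, so the notation is consistent.) *)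

theory Defs
  imports Complex_Main
begin

text \<open>
  A vector of length \<open>N\<close> is a function on \<open>nat\<close>, of which only the values at the indices
  \<open>0, \<dots>, N - 1\<close> are ever used.
\<close>

definition dct_scale :: "nat \<Rightarrow> real" where
  "dct_scale k = (if k = 0 then 1 / sqrt 2 else 1)"

definition dct :: "nat \<Rightarrow> (nat \<Rightarrow> real) \<Rightarrow> nat \<Rightarrow> real" where
  "dct N v k = sqrt (2 / real N) * dct_scale k *
     (\<Sum>n<N. v n * cos (pi * real k * (real n + 1 / 2) / real N))"

text \<open>The inverse DCT formula for the spectrum of \<open>v\<close>, evaluated at an arbitrary real index \<open>r\<close>.\<close>

definition fractional_sample :: "nat \<Rightarrow> (nat \<Rightarrow> real) \<Rightarrow> real \<Rightarrow> real" where
  "fractional_sample N v r = sqrt (2 / real N) *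
     (\<Sum>k<N. dct_scale k * dct N v k * cos (pi * real k * (r + 1 / 2) / real N))"

definition sample_weight :: "nat \<Rightarrow> nat \<Rightarrow> real \<Rightarrow> real" where
  "sample_weight N n r = - (1 / real N) + 2 / real N *
     (\<Sum>k<N. cos (pi * real k * (real n + 1 / 2) / real N) *
             cos (pi * real k * (r + 1 / 2) / real N))"

end

theory Submission
  imports Defs
begin

text \<open>
  Substituting the spectrum into the inverse formula and exchanging the two finite sums shows that
  the coefficient of \<open>v n\<close> in the sample at index \<open>r\<close> is \<open>2 / N\<close> times the sum over \<open>k\<close> of the
  cosine products, each with the factor \<open>(dct_scale k)\<^sup>2\<close>. This factor is \<open>1\<close> except for \<open>k = 0\<close>,
  where it is \<open>1 / 2\<close> and both cosines are \<open>1\<close>. Dropping the factor therefore adds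
  \<open>2 / N * (1 / 2) = 1 / N\<close>, and the summand \<open>- 1 / N\<close> of the weight compensates for this.
\<close>

lemma dct_scale_square: "(dct_scale k)\<^sup>2 = (if k = 0 then 1 / 2 else 1)"
  by (simp add: dct_scale_def power_divide)

lemma sample_weight_scaled:
  assumes "N \<ge> 1"
  shows "sample_weight N n r = 2 / real N *
    (\<Sum>k<N. (dct_scale k)\<^sup>2 * (cos (pi * real k * (real n + 1 / 2) / real N) *
             cos (pi * real k * (r + 1 / 2) / real N)))"
proof -
  define c where "c k = cos (pi * real k * (real n + 1 / 2) / real N) *
             cos (pi * real k * (r + 1 / 2) / real N)" for k
  have "(\<Sum>k<N. (dct_scale k)\<^sup>2 * c k) = (\<Sum>k<N. c k - (if k = 0 then 1 / 2 else 0))"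
    by (intro sum.cong) (auto simp: dct_scale_square c_def)
  also have "\<dots> = (\<Sum>k<N. c k) - 1 / 2"
    using assms by (simp add: sum_subtractf sum.delta)
  finally have "(\<Sum>k<N. (dct_scale k)\<^sup>2 * c k) = (\<Sum>k<N. c k) - 1 / 2" .
  then show ?thesis
    unfolding sample_weight_def c_def[symmetric] by (simp add: right_diff_distrib)
qed

theorem mainTheorem3:
  fixes N :: nat and v :: "nat \<Rightarrow> real" and r :: real
  assumes "N \<ge> 1"
  shows "fractional_sample N v r = (\<Sum>n<N. sample_weight N n r * v n)"
proof -
  define s where "s = sqrt (2 / real N)"
  define a where "a k n = cos (pi * real k * (real n + 1 / 2) / real N)" for k n
  define b where "b k = cos (pi * real k * (r + 1 / 2) / real N)" for k
  have s: "s * s = 2 / real N"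
    by (simp add: s_def)
  have "fractional_sample N v r =
      (\<Sum>k<N. \<Sum>n<N. (s * s) * ((dct_scale k)\<^sup>2 * (a k n * b k)) * v n)"
    unfolding fractional_sample_def dct_def s_def[symmetric] a_def[symmetric] b_def[symmetric]
    by (simp add: sum_distrib_left sum_distrib_right power2_eq_square mult_ac)
  also have "\<dots> = (\<Sum>n<N. \<Sum>k<N. (s * s) * ((dct_scale k)\<^sup>2 * (a k n * b k)) * v n)"
    by (rule sum.swap)
  also have "\<dots> = (\<Sum>n<N. sample_weight N n r * v n)"
    unfolding sample_weight_scaled[OF assms] a_def[symmetric] b_def[symmetric] s
    by (simp add: sum_distrib_left sum_distrib_right)
  finally show ?thesis .
qed

end
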